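(* Let $p$ be a prime, $n$ a positive integer and $r$ an odd positive integer. Then $A^r_n$ has at least $$\frac{n-1-r\cdot d_p(n)}{p-1}$$ factors of $p$.
   Context: Write $[m]=\{1,2,\ldots,m\}$ (so $[0]=\emptyset$). For a permutation $\pi$ in the symmetric group $\mathfrak{S}_n$, its descent set is $\mathrm{Des}(\pi)=\{i\in[n-1] : \pi_i>\pi_{i+1}\}$. For $S\subseteq[n-1]$, $\beta_n(S)=|\{\pi\in\mathfrak{S}_n : \mathrm{Des}(\pi)=S\}|$. Define $A^r_n=\sum_{S\subseteq[n-1]}\beta_n(S)^r$. For a positive integer $n$, $u_p(n)$ is the sum of the base $p$ digits of $n$, and $d_p(n)=u_p(n)-1$. An integer $N$ has at least $c$ factors of $p$ ($c$ a real number) if the exponent of $p$ in $N$ (its $p$-adic valuation) is at least $c$. *)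

theory Defs
  imports Complex_Main "HOL-Combinatorics.Permutations"
    "HOL-Computational_Algebra.Primes"
begin

definition descent_set :: "nat \<Rightarrow> (nat \<Rightarrow> nat) \<Rightarrow> nat set" where
  "descent_set n \<pi> = {i \<in> {1..n - 1}. \<pi> i > \<pi> (i + 1)}"

definition descent_count :: "nat \<Rightarrow> nat set \<Rightarrow> nat" where
  "descent_count n S = card {\<pi>. \<pi> permutes {1..n} \<and> descent_set n \<pi> = S}"

definition descent_power_sum :: "nat \<Rightarrow> nat \<Rightarrow> nat" where
  "descent_power_sum r n = (\<Sum>S\<in>Pow {1..n - 1}. descent_count n S ^ r)"

(* The digit of n at position i is n div p ^ i mod p; it vanishes once p ^ i > n.
   The index set is finite for p \<ge> 2, which is the only case of interest. *)
definition digit_sum :: "nat \<Rightarrow> nat \<Rightarrow> nat" where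
  "digit_sum p n = (\<Sum>i | p ^ i \<le> n. n div p ^ i mod p)"

definition digit_defect :: "nat \<Rightarrow> nat \<Rightarrow> int" where
  "digit_defect p n = int (digit_sum p n) - 1"

end

theory Submission
  imports Defs "HOL-Combinatorics.Multiset_Permutations"
begin

text \<open>
  Let \<open>a(T)\<close> be the number of permutations whose descent set is contained in \<open>T\<close>. Writing
  \<open>\<beta>(S)\<close> as an alternating sum of \<open>a(T)\<close> over \<open>T \<subseteq> S\<close> and expanding the \<open>r\<close>-th power, the sum
  over \<open>S\<close> has signs \<open>(-1)^(r |S|) = (-1)^|S|\<close>, as \<open>r\<close> is odd. It cancels unless
  \<open>T\<^sub>1 \<union> \<dots> \<union> T\<^sub>r = [n - 1]\<close>. Each \<open>a(T)\<close> is a multinomial coefficient with \<open>|T| + 1\<close> parts, whose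
  \<open>p\<close>-adic valuation is at least \<open>(|T| - d\<^sub>p(n)) / (p - 1)\<close> by Legendre's formula, and
  \<open>|T\<^sub>1| + \<dots> + |T\<^sub>r| \<ge> n - 1\<close> for every surviving term.
\<close>

section \<open>Digit sums and Legendre's formula\<close>

lemma digit_sum_0 [simp]: "p \<ge> 2 \<Longrightarrow> digit_sum p 0 = 0"
  by (simp add: digit_sum_def)

lemma finite_power_le:
  fixes p n :: nat
  assumes "p \<ge> 2"
  shows "finite {i. p ^ i \<le> n}"
proof (rule finite_subset)
  show "{i. p ^ i \<le> n} \<subseteq> {..n}"
  proof
    fix i assume "i \<in> {i. p ^ i \<le> n}"
    moreover have "i < p ^ i"
      using assms by (simp add: power_gt_expt)
    ultimately show "i \<in> {..n}" by simp
  qed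
qed simp

lemma digit_sum_rec:
  assumes p: "p \<ge> 2"
  shows "digit_sum p n = n mod p + digit_sum p (n div p)"
proof (cases "n = 0")
  case False
  \<comment> \<open>As \<open>n\<close> is positive, position 0 is an index; every other index is
    one for \<open>n div p\<close>, shifted up by one.\<close>
  have "{i. p ^ i \<le> n} = insert 0 (Suc ` {i. p ^ i \<le> n div p})"
  proof (intro set_eqI)
    fix i show "i \<in> {i. p ^ i \<le> n} \<longleftrightarrow> i \<in> insert 0 (Suc ` {i. p ^ i \<le> n div p})"
      using False p by (cases i) (auto simp: less_eq_div_iff_mult_less_eq mult.commute)
  qed
  then show ?thesis
    using finite_power_le[OF p, of "n div p"]
    by (simp add: digit_sum_def sum.reindex div_mult2_eq)
qed (use p in simp)

text \<open>Adding 1 turns the trailing digits \<open>p - 1\<close> of \<open>n\<close> into 0, and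
  their number is the exponent of \<open>p\<close> in \<open>Suc n\<close>. Each such carry costs
  \<open>p - 1\<close> in the digit sum. The induction strips one trailing digit at a time.\<close>

lemma digit_sum_Suc:
  assumes p: "prime p"
  shows "digit_sum p (Suc n) + (p - 1) * multiplicity p (Suc n) = digit_sum p n + 1"
proof (induction n rule: less_induct)
  case (less n)
  have p2: "p \<ge> 2" using p by (rule prime_ge_2_nat)
  show ?case
  proof (cases "p dvd Suc n")
    case False
    then have "Suc n mod p = Suc (n mod p)" "Suc n div p = n div p"
      by (auto simp: mod_Suc div_Suc dvd_eq_mod_eq_0 split: if_splits)
    with False show ?thesis
      by (simp add: digit_sum_rec[OF p2, of "Suc n"] digit_sum_rec[OF p2, of n]
          not_dvd_imp_multiplicity_0)
  next
    case True
    define q where "q = n div p"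
    have mods: "Suc n mod p = 0" "Suc (n mod p) = p"
      using True p2 by (auto simp: mod_Suc dvd_eq_mod_eq_0 split: if_splits)
    have divs: "Suc n div p = Suc q"
      using True by (simp add: div_Suc q_def dvd_eq_mod_eq_0)
    have Suc_n: "Suc n = p * Suc q"
      using True divs by (metis dvd_mult_div_cancel)
    then have "Suc q < Suc n"
      using p2 n_less_m_mult_n[of "Suc q" p] by simp
    then have IH: "digit_sum p (Suc q) + (p - 1) * multiplicity p (Suc q) = digit_sum p q + 1"
      by (intro less.IH) simp
    have "multiplicity p (Suc n) = Suc (multiplicity p (Suc q))"
      unfolding Suc_n using p by (subst multiplicity_times_same) (auto simp: prime_gt_0_nat)
    with IH mods divs p2 show ?thesis
      by (simp add: digit_sum_rec[OF p2, of "Suc n"] digit_sum_rec[OF p2, of n] flip: q_def)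
  qed
qed

text \<open>Legendre's formula, cleared of subtraction and division; it is the telescoped form of
  \<open>digit_sum_Suc\<close>.\<close>

lemma multiplicity_fact_digit_sum:
  assumes p: "prime p"
  shows "(p - 1) * multiplicity p (fact n) + digit_sum p n = n"
proof (induction n)
  case 0
  then show ?case using prime_ge_2_nat[OF p] by simp
next
  case (Suc n)
  have "multiplicity p (fact (Suc n)) = multiplicity p (Suc n) + multiplicity p (fact n :: nat)"
    using p by (simp add: prime_elem_multiplicity_mult_distrib del: mult_Suc)
  with Suc digit_sum_Suc[OF p, of n] show ?case
    by (simp add: add_mult_distrib2)
qed

lemma digit_sum_pos:
  assumes "prime p" "n > 0"
  shows "digit_sum p n > 0"
  using assms(2)
proof (induction n rule: less_induct)
  case (less n)
  have p2: "p \<ge> 2" using assms(1) by (rule prime_ge_2_nat)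
  show ?case
  proof (cases "n mod p = 0")
    case True
    then have "n div p > 0" "n div p < n"
      using less.prems p2 by (auto simp: div_greater_zero_iff dvd_imp_le dvd_eq_mod_eq_0)
    then show ?thesis
      using less.IH[of "n div p"] by (simp add: digit_sum_rec[OF p2, of n])
  qed (simp add: digit_sum_rec[OF p2, of n])
qed

text \<open>Legendre's formula for the three factorials of the binomial coefficient. This is
  Kummer's theorem: the exponent counts the carries when \<open>m\<close> and \<open>n - m\<close>
  are added in base \<open>p\<close>.\<close>

lemma multiplicity_binomial_digit_sum:
  assumes p: "prime p" and "m \<le> n"
  shows "(p - 1) * multiplicity p (n choose m) + digit_sum p n
           = digit_sum p m + digit_sum p (n - m)"
proof -
  have "fact n = (fact m * fact (n - m) :: nat) * (n choose m)"
    using binomial_fact_lemma[OF assms(2)] by simp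
  then have "multiplicity p (fact n)
      = multiplicity p (fact m :: nat) + multiplicity p (fact (n - m) :: nat)
        + multiplicity p (n choose m)"
    using assms by (simp add: prime_elem_multiplicity_mult_distrib)
  then have "(p - 1) * multiplicity p (fact n)
      = (p - 1) * multiplicity p (fact m :: nat) + (p - 1) * multiplicity p (fact (n - m) :: nat)
        + (p - 1) * multiplicity p (n choose m)"
    by (simp add: distrib_left)
  with multiplicity_fact_digit_sum[OF p, of n] multiplicity_fact_digit_sum[OF p, of m]
    multiplicity_fact_digit_sum[OF p, of "n - m"] assms(2)
  show ?thesis by linarith
qed

section \<open>Arrangements with prescribed possible descents\<close>

text \<open>Positions count from 1 although list entries are indexed from 0, so that the result
  matches \<open>descent_set\<close> for a permutation in one-line notation.\<close>

definition list_descents :: "'a::linorder list \<Rightarrow> nat set" where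
  "list_descents xs = {i \<in> {1..<length xs}. xs ! (i - 1) > xs ! i}"

text \<open>The ground set is arbitrary because the recursion passes to initial segments, whose
  entries form an arbitrary subset; lists make relabelling to an interval unnecessary.\<close>

definition arrangements :: "'a::linorder set \<Rightarrow> nat set \<Rightarrow> 'a list set" where
  "arrangements A T = {xs \<in> permutations_of_set A. list_descents xs \<subseteq> T}"

lemma finite_arrangements [simp]: "finite (arrangements A T)"
  by (simp add: arrangements_def)

lemma list_descents_empty_iff: "list_descents xs = {} \<longleftrightarrow> sorted xs"
proof
  assume *: "list_descents xs = {}"
  show "sorted xs"
    unfolding sorted_iff_nth_Suc
  proof (intro allI impI)
    fix i assume "Suc i < length xs"
    with * have "\<not> xs ! (Suc i - 1) > xs ! Suc i"
      unfolding list_descents_def by fastforce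
    then show "xs ! i \<le> xs ! Suc i" by simp
  qed
next
  assume "sorted xs"
  then show "list_descents xs = {}"
    by (auto simp: list_descents_def not_less intro!: sorted_nth_mono)
qed

text \<open>The junction of the two lists is position \<open>length ys\<close>, where a descent is
  allowed, so the halves do not interact. Descents of \<open>zs\<close> are shifted beyond every
  allowed position, so there can be none.\<close>

lemma list_descents_append_subset_iff:
  assumes "T \<subseteq> {1..<length ys}"
  shows "list_descents (ys @ zs) \<subseteq> insert (length ys) T \<longleftrightarrow> list_descents ys \<subseteq> T \<and> sorted zs"
    (is "?L \<longleftrightarrow> ?R")
proof
  assume L: ?L
  have "list_descents ys \<subseteq> T"
  proof
    fix i assume i: "i \<in> list_descents ys"
    then have "i \<in> list_descents (ys @ zs)" by (auto simp: list_descents_def nth_append)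
    with L i show "i \<in> T" by (auto simp: list_descents_def)
  qed
  moreover have "list_descents zs = {}"
  proof (rule ccontr)
    assume "list_descents zs \<noteq> {}"
    then obtain i where i: "i \<in> list_descents zs" by auto
    then have "length ys + i \<in> list_descents (ys @ zs)"
      by (cases i) (auto simp: list_descents_def nth_append)
    with L have "length ys + i \<in> insert (length ys) T" by blast
    with i assms show False by (auto simp: list_descents_def)
  qed
  ultimately show ?R by (simp add: list_descents_empty_iff)
next
  assume R: ?R
  show ?L
  proof
    fix i assume i: "i \<in> list_descents (ys @ zs)"
    consider "i < length ys" | "i = length ys" | "i > length ys" by linarith
    then show "i \<in> insert (length ys) T"
    proof cases
      case 1
      then have "i \<in> list_descents ys"
        using i by (auto simp: list_descents_def nth_append split: if_splits)
      with R show ?thesis by auto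
    next
      case 3
      then have "i - length ys \<in> list_descents zs"
        using i by (auto simp: list_descents_def nth_append split: if_splits)
      with R show ?thesis by (simp flip: list_descents_empty_iff)
    qed simp
  qed
qed

text \<open>Since \<open>m\<close> lies above all of \<open>T\<close>, an arrangement amounts to a
  choice of the set \<open>B\<close> of its first \<open>m\<close> entries and an arrangement of
  \<open>B\<close>: the remaining entries must increase, hence are determined.\<close>

lemma card_arrangements_insert:
  fixes A :: "'a::linorder set"
  assumes A: "finite A" "card A = n" and m: "m \<le> n" and T: "T \<subseteq> {1..<m}"
    and N: "\<And>B :: 'a set. finite B \<Longrightarrow> card B = m \<Longrightarrow> card (arrangements B T) = N"
  shows "card (arrangements A (insert m T)) = (n choose m) * N"
proof -
  let ?I = "{B. B \<subseteq> A \<and> card B = m}"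
  have "bij_betw (\<lambda>(B, ys). ys @ sorted_list_of_set (A - B))
          (SIGMA B:?I. arrangements B T) (arrangements A (insert m T))"
  proof (rule bij_betw_byWitness[where f' = "\<lambda>xs. (set (take m xs), take m xs)"])
    have inI: "finite B" "length ys = m" "set ys = B" "distinct ys"
      if "B \<in> ?I" "ys \<in> arrangements B T" for B ys
      using that finite_subset[OF _ A(1), of B]
      by (auto simp: arrangements_def permutations_of_set_def distinct_card[symmetric])
    show "\<forall>x\<in>SIGMA B:?I. arrangements B T.
        (\<lambda>xs. (set (take m xs), take m xs)) ((\<lambda>(B, ys). ys @ sorted_list_of_set (A - B)) x) = x"
    proof
      fix x assume "x \<in> (SIGMA B:?I. arrangements B T)"
      then obtain B ys where x: "x = (B, ys)" and "B \<in> ?I" "ys \<in> arrangements B T"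
        by (rule SigmaE)
      from inI[OF this(2,3)]
      show "(\<lambda>xs. (set (take m xs), take m xs)) ((\<lambda>(B, ys). ys @ sorted_list_of_set (A - B)) x) = x"
        by (simp add: x)
    qed
    have inA: "sorted (drop m xs)" "list_descents (take m xs) \<subseteq> T"
      "set (drop m xs) = A - set (take m xs)" "card (set (take m xs)) = m"
      "distinct xs" "set xs = A"
      if "xs \<in> arrangements A (insert m T)" for xs
    proof -
      from that show ds: "distinct xs" "set xs = A"
        by (auto simp: arrangements_def permutations_of_set_def)
      with A have len: "length xs = n" by (metis distinct_card)
      have "list_descents (take m xs @ drop m xs) \<subseteq> insert (length (take m xs)) T"
        using that len m by (simp add: arrangements_def)
      then show "sorted (drop m xs)" "list_descents (take m xs) \<subseteq> T"
        using T len m list_descents_append_subset_iff[of T "take m xs" "drop m xs"]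
        by (auto simp: min_absorb2)
      have "distinct (take m xs @ drop m xs)" "set (take m xs @ drop m xs) = A"
        using ds by simp_all
      then show "set (drop m xs) = A - set (take m xs)"
        unfolding distinct_append set_append by blast
      show "card (set (take m xs)) = m"
        using ds len m by (simp add: distinct_card)
    qed
    show "\<forall>xs\<in>arrangements A (insert m T).
        (\<lambda>(B, ys). ys @ sorted_list_of_set (A - B)) (set (take m xs), take m xs) = xs"
    proof
      fix xs assume xs: "xs \<in> arrangements A (insert m T)"
      \<comment> \<open>The tail is sorted and distinct, so it can be recovered from its set of
        entries.\<close>
      have "sorted_list_of_set (set (drop m xs)) = drop m xs"
        using inA[OF xs] by (intro sorted_list_of_set.idem_if_sorted_distinct) auto
      then show "(\<lambda>(B, ys). ys @ sorted_list_of_set (A - B)) (set (take m xs), take m xs) = xs"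
        using inA(3)[OF xs] by simp
    qed
    show "(\<lambda>(B, ys). ys @ sorted_list_of_set (A - B)) ` (SIGMA B:?I. arrangements B T)
        \<subseteq> arrangements A (insert m T)"
    proof (rule image_subsetI)
      fix x assume "x \<in> (SIGMA B:?I. arrangements B T)"
      then obtain B ys where x: "x = (B, ys)" and B: "B \<in> ?I" and ys: "ys \<in> arrangements B T"
        by (rule SigmaE)
      note * = inI[OF B ys]
      have "list_descents (ys @ sorted_list_of_set (A - B)) \<subseteq> insert (length ys) T"
        using T ys * by (subst list_descents_append_subset_iff) (auto simp: arrangements_def)
      then show "(\<lambda>(B, ys). ys @ sorted_list_of_set (A - B)) x \<in> arrangements A (insert m T)"
        using * B A(1) by (auto simp: x arrangements_def permutations_of_set_def)
    qed
    show "(\<lambda>xs. (set (take m xs), take m xs)) ` arrangements A (insert m T)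
        \<subseteq> (SIGMA B:?I. arrangements B T)"
    proof (rule image_subsetI)
      fix xs assume xs: "xs \<in> arrangements A (insert m T)"
      have "take m xs \<in> arrangements (set (take m xs)) T"
        using inA[OF xs] by (simp add: arrangements_def permutations_of_set_def)
      moreover have "set (take m xs) \<in> ?I"
        using inA[OF xs] set_take_subset[of m xs] by simp
      ultimately show "(set (take m xs), take m xs) \<in> (SIGMA B:?I. arrangements B T)"
        by (intro SigmaI)
    qed
  qed
  then have "card (arrangements A (insert m T)) = card (SIGMA B:?I. arrangements B T)"
    by (simp add: bij_betw_same_card)
  also have "\<dots> = (\<Sum>B\<in>?I. card (arrangements B T))"
    using A(1) by (subst card_SigmaI) auto
  also have "\<dots> = (\<Sum>B\<in>?I. N)"
    using A(1) by (intro sum.cong N) (auto intro: finite_subset)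
  also have "\<dots> = (n choose m) * N"
    using A by (simp add: n_subsets)
  finally show ?thesis .
qed

text \<open>Removing the maximum \<open>m\<close> of \<open>T\<close> splits off the factor
  \<open>n choose m\<close>, so the count is a multinomial coefficient. \<open>N\<close> is chosen
  before \<open>A\<close>, since the recursion needs one value for all sets of a given size. The
  inequality is the bound \<open>k >= (card T - d) / (p - 1)\<close> with
  \<open>d = digit_sum p n - 1\<close>.\<close>

lemma prime_power_dvd_card_arrangements:
  assumes p: "prime p" and "finite T" "T \<subseteq> {1..<n}" "n > 0"
  shows "\<exists>N k. (\<forall>A :: 'a::linorder set. finite A \<longrightarrow> card A = n \<longrightarrow> card (arrangements A T) = N)
           \<and> p ^ k dvd N \<and> card T + 1 \<le> (p - 1) * k + digit_sum p n"
  using assms(2-4)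
proof (induction T arbitrary: n rule: finite_linorder_max_induct)
  case empty
  have "card (arrangements A {}) = 1" if "finite A" for A :: "'a set"
  proof -
    have "arrangements A {} = {sorted_list_of_set A}"
      using that
      by (auto simp: arrangements_def permutations_of_set_def list_descents_empty_iff
          sorted_list_of_set.idem_if_sorted_distinct)
    then show ?thesis by simp
  qed
  with digit_sum_pos[OF p empty(2)] show ?case
    by (intro exI[of _ 1] exI[of _ 0]) auto
next
  case (insert m T)
  have m: "m > 0" "m < n" "T \<subseteq> {1..<m}" "m \<notin> T"
    using insert.prems insert.hyps by auto
  from insert.IH[OF m(3) m(1)] obtain N k
    where N: "\<And>A :: 'a set. finite A \<Longrightarrow> card A = m \<Longrightarrow> card (arrangements A T) = N"
      and k: "p ^ k dvd N" "card T + 1 \<le> (p - 1) * k + digit_sum p m"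
    by auto
  let ?v = "multiplicity p (n choose m)"
  have "p ^ (?v + k) dvd (n choose m) * N"
    using k(1) by (simp add: power_add mult_dvd_mono multiplicity_dvd)
  \<comment> \<open>Kummer's theorem trades \<open>digit_sum p m\<close> for
    \<open>digit_sum p n\<close> and leaves a surplus of \<open>digit_sum p (n - m)\<close>. This is
    at least 1, which pays for the new element of \<open>T\<close>.\<close>
  moreover have "card (insert m T) + 1 \<le> (p - 1) * (?v + k) + digit_sum p n"
    using multiplicity_binomial_digit_sum[OF p, of m n] digit_sum_pos[OF p, of "n - m"]
      m k(2) insert.hyps(1) by (simp add: distrib_left)
  moreover have "card (arrangements A (insert m T)) = (n choose m) * N"
    if "finite A" "card A = n" for A :: "'a set"
    using that m N by (intro card_arrangements_insert) auto
  ultimately show ?case by blast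
qed

section \<open>From lists back to permutations: the numbers \<open>a(T)\<close>\<close>

definition descent_subset_count :: "nat \<Rightarrow> nat set \<Rightarrow> nat" where
  "descent_subset_count n T = card {\<pi>. \<pi> permutes {1..n} \<and> descent_set n \<pi> \<subseteq> T}"

lemma descent_subset_count_eq_card_arrangements:
  "descent_subset_count n T = card (arrangements {1..n} T)"
proof -
  let ?f = "\<lambda>\<pi>. map \<pi> [1..<Suc n]"
  have desc: "list_descents (?f \<pi>) = descent_set n \<pi>" for \<pi> :: "nat \<Rightarrow> nat"
    by (auto simp: list_descents_def descent_set_def nth_append simp del: upt_Suc)
  have "bij_betw ?f {\<pi>. \<pi> permutes {1..n} \<and> descent_set n \<pi> \<subseteq> T} (arrangements {1..n} T)"
    unfolding bij_betw_def
  proof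
    show "inj_on ?f {\<pi>. \<pi> permutes {1..n} \<and> descent_set n \<pi> \<subseteq> T}"
    proof (rule inj_onI, rule ext)
      fix \<pi> \<sigma> x
      assume "\<pi> \<in> {\<pi>. \<pi> permutes {1..n} \<and> descent_set n \<pi> \<subseteq> T}"
        "\<sigma> \<in> {\<pi>. \<pi> permutes {1..n} \<and> descent_set n \<pi> \<subseteq> T}" "?f \<pi> = ?f \<sigma>"
      then show "\<pi> x = \<sigma> x"
        by (cases "x \<in> {1..n}") (auto simp: permutes_not_in simp del: upt_Suc)
    qed
    show "?f ` {\<pi>. \<pi> permutes {1..n} \<and> descent_set n \<pi> \<subseteq> T} = arrangements {1..n} T"
    proof (intro equalityI subsetI)
      fix xs assume "xs \<in> ?f ` {\<pi>. \<pi> permutes {1..n} \<and> descent_set n \<pi> \<subseteq> T}"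
      then obtain \<pi> where \<pi>: "\<pi> permutes {1..n}" "descent_set n \<pi> \<subseteq> T" and xs: "xs = ?f \<pi>"
        by blast
      have "set xs = {1..n}"
        using permutes_image[OF \<pi>(1)] unfolding xs set_map set_upt atLeastLessThanSuc_atLeastAtMost .
      moreover have "distinct xs"
        using permutes_inj_on[OF \<pi>(1)] unfolding xs
        by (simp add: distinct_map del: upt_Suc)
      moreover have "list_descents xs \<subseteq> T"
        using \<pi>(2) unfolding xs desc .
      ultimately show "xs \<in> arrangements {1..n} T"
        by (simp add: arrangements_def permutations_of_setI)
    next
      fix xs assume "xs \<in> arrangements {1..n} T"
      then have xs: "set xs = {1..n}" "distinct xs" "list_descents xs \<subseteq> T"
        by (auto simp: arrangements_def permutations_of_set_def)
      then have len: "length xs = n" using distinct_card by fastforce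
      \<comment> \<open>The shift by one reconciles list indices with \<open>{1..n}\<close>; outside
        this interval \<open>permutes\<close> demands the identity.\<close>
      define \<pi> where "\<pi> i = (if i \<in> {1..n} then xs ! (i - 1) else i)" for i
      have f: "?f \<pi> = xs"
        by (rule nth_equalityI) (auto simp: len \<pi>_def simp del: upt_Suc)
      have "bij_betw \<pi> {1..n} {1..n}"
      proof (rule bij_betw_imageI)
        show "inj_on \<pi> {1..n}"
          using xs(2) len by (auto simp: inj_on_def \<pi>_def nth_eq_iff_index_eq)
        show "\<pi> ` {1..n} = {1..n}"
          using arg_cong[OF f, of set] xs(1) atLeastLessThanSuc_atLeastAtMost[of 1 n]
          by (simp del: upt_Suc)
      qed
      then have "\<pi> permutes {1..n}"
        by (intro bij_imp_permutes) (auto simp: \<pi>_def)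
      with f desc[of \<pi>] xs(3)
      show "xs \<in> ?f ` {\<pi>. \<pi> permutes {1..n} \<and> descent_set n \<pi> \<subseteq> T}" by auto
    qed
  qed
  then show ?thesis
    unfolding descent_subset_count_def by (rule bij_betw_same_card)
qed

corollary prime_power_dvd_descent_subset_count:
  assumes "prime p" "T \<subseteq> {1..n - 1}" "n > 0"
  obtains k where "p ^ k dvd descent_subset_count n T"
    "card T + 1 \<le> (p - 1) * k + digit_sum p n"
proof -
  have "{1..n - 1} = {1..<n}"
    using assms(3) by auto
  with assms(2) have "T \<subseteq> {1..<n}" "finite T"
    by (auto intro: finite_subset)
  then show ?thesis
    using prime_power_dvd_card_arrangements[OF assms(1), of T n, where ?'a = nat] assms(3) that
    by (auto simp: descent_subset_count_eq_card_arrangements)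
qed

lemma descent_subset_count_eq_sum:
  assumes "finite T"
  shows "descent_subset_count n T = (\<Sum>S\<in>Pow T. descent_count n S)"
proof -
  have "{\<pi>. \<pi> permutes {1..n} \<and> descent_set n \<pi> \<subseteq> T}
      = (\<Union>S\<in>Pow T. {\<pi>. \<pi> permutes {1..n} \<and> descent_set n \<pi> = S})" by auto
  then show ?thesis
    unfolding descent_subset_count_def descent_count_def
    using assms by (subst card_UN_disjoint[symmetric]) (auto simp: finite_permutations)
qed

section \<open>Odd power sums over a Boolean lattice\<close>

text \<open>If an element of \<open>X\<close> is missing from \<open>U\<close>, toggling it pairs
  the sets in between with opposite signs.\<close>

lemma sum_alternating_supersets:
  assumes "finite X" "U \<subseteq> X"
  shows "(\<Sum>S | S \<subseteq> X \<and> U \<subseteq> S. (-1) ^ card S)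
           = (if U = X then (-1) ^ card X else (0 :: 'b::ring_1))"
proof (cases "U = X")
  case True
  then have "{S. S \<subseteq> X \<and> U \<subseteq> S} = {X}" by auto
  with True show ?thesis by simp
next
  case False
  with assms show ?thesis
    by (simp add: sum_alternating_cancels card_subsupersets_even_odd psubset_eq)
qed

text \<open>Moebius inversion expresses \<open>f\<close> through \<open>g\<close>, and the
  \<open>r\<close>-th power expands into a sum over \<open>r\<close>-tuples \<open>h\<close> of
  subsets. After the sums are exchanged, only a sign depends on \<open>S\<close>, and its
  alternating sum kills every tuple that does not cover \<open>X\<close>.\<close>

lemma sum_odd_power_Pow:
  fixes f g :: "'a set \<Rightarrow> 'b::comm_ring_1"
  assumes X: "finite X" and r: "odd r" and g: "\<And>S. finite S \<Longrightarrow> g S = sum f (Pow S)"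
  shows "(\<Sum>S\<in>Pow X. f S ^ r)
    = (\<Sum>h | h \<in> {..<r} \<rightarrow>\<^sub>E Pow X \<and> (\<Union>j<r. h j) = X.
         (-1) ^ card X * (\<Prod>j<r. (-1) ^ card (h j) * g (h j)))"
proof -
  let ?H = "{..<r} \<rightarrow>\<^sub>E Pow X"
  define w where "w T = (-1) ^ card T * g T" for T
  have finH: "finite ?H" using X by (intro finite_PiE) auto
  have pow: "f S ^ r = (\<Sum>h | h \<in> ?H \<and> (\<Union>j<r. h j) \<subseteq> S. (-1) ^ card S * (\<Prod>j<r. w (h j)))"
    if S: "S \<subseteq> X" for S
  proof -
    have finS: "finite S" using S X finite_subset by blast
    have "f S = (\<Sum>T\<in>Pow S. (-1) ^ (card S - card T) * g T)"
      using g finS by (rule inclusion_exclusion_mobius)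
    also have "\<dots> = (-1) ^ card S * (\<Sum>T\<in>Pow S. w T)"
      unfolding sum_distrib_left w_def
    proof (intro sum.cong refl)
      fix T assume "T \<in> Pow S"
      \<comment> \<open>With this inequality the truncated difference in the exponent has the parity
        of \<open>card S + card T\<close>, so the sign factors.\<close>
      then have "card T \<le> card S" using finS by (simp add: card_mono)
      then show "(-1) ^ (card S - card T) * g T = (-1) ^ card S * ((-1) ^ card T * g T)"
        by (simp only: power_add mult.assoc flip: neg_one_power_add_eq_neg_one_power_diff)
    qed
    finally have "f S ^ r = ((-1) ^ card S) ^ r * (\<Sum>T\<in>Pow S. w T) ^ r"
      by (simp add: power_mult_distrib)
    \<comment> \<open>Oddness of \<open>r\<close> enters here: an even power would erase the sign on
      which the cancellation rests.\<close>
    also have "((-1) ^ card S) ^ r = ((-1) ^ card S :: 'b)"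
      using r by (cases "even (card S)") auto
    also have "(\<Sum>T\<in>Pow S. w T) ^ r = (\<Sum>h\<in>{..<r} \<rightarrow>\<^sub>E Pow S. \<Prod>j<r. w (h j))"
      using prod_sum_PiE[of "{..<r}" "\<lambda>_. Pow S" "\<lambda>_. w"] finS by simp
    \<comment> \<open>Tuples of subsets of \<open>S\<close> are recast as tuples of subsets of
      \<open>X\<close> whose union lies in \<open>S\<close>. The range of \<open>h\<close> then no
      longer depends on \<open>S\<close>, and the summations can be swapped.\<close>
    also have "{..<r} \<rightarrow>\<^sub>E Pow S = {h. h \<in> ?H \<and> (\<Union>j<r. h j) \<subseteq> S}"
    proof (rule set_eqI)
      fix h
      have "(\<forall>j<r. h j \<subseteq> S) \<longleftrightarrow> (\<forall>j<r. h j \<subseteq> X) \<and> (\<forall>j<r. h j \<subseteq> S)"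
        using S by (meson subset_trans)
      then show "h \<in> {..<r} \<rightarrow>\<^sub>E Pow S \<longleftrightarrow> h \<in> {h. h \<in> ?H \<and> (\<Union>j<r. h j) \<subseteq> S}"
        unfolding mem_Collect_eq PiE_iff UN_subset_iff Pow_iff Ball_def lessThan_iff by argo
    qed
    finally show ?thesis by (simp add: sum_distrib_left)
  qed
  have "(\<Sum>S\<in>Pow X. f S ^ r)
      = (\<Sum>S\<in>Pow X. \<Sum>h | h \<in> ?H \<and> (\<Union>j<r. h j) \<subseteq> S. (-1) ^ card S * (\<Prod>j<r. w (h j)))"
    using pow by (intro sum.cong) auto
  also have "\<dots> = (\<Sum>h\<in>?H. \<Sum>S | S \<in> Pow X \<and> (\<Union>j<r. h j) \<subseteq> S. (-1) ^ card S * (\<Prod>j<r. w (h j)))"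
    using X finH by (intro sum.swap_restrict) auto
  also have "\<dots> = (\<Sum>h\<in>?H. if (\<Union>j<r. h j) = X then (-1) ^ card X * (\<Prod>j<r. w (h j)) else 0)"
  proof (intro sum.cong refl)
    fix h assume "h \<in> ?H"
    then have "(\<Union>j<r. h j) \<subseteq> X" by (auto simp: PiE_iff)
    from sum_alternating_supersets[OF X this, where ?'b = 'b]
    show "(\<Sum>S | S \<in> Pow X \<and> (\<Union>j<r. h j) \<subseteq> S. (-1) ^ card S * (\<Prod>j<r. w (h j)))
        = (if (\<Union>j<r. h j) = X then (-1) ^ card X * (\<Prod>j<r. w (h j)) else 0)"
      by (simp flip: sum_distrib_right)
  qed
  also have "\<dots> = (\<Sum>h | h \<in> ?H \<and> (\<Union>j<r. h j) = X. (-1) ^ card X * (\<Prod>j<r. w (h j)))"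
    using finH by (intro sum.inter_filter[symmetric])
  finally show ?thesis by (simp add: w_def)
qed

section \<open>Divisibility of the descent power sum\<close>

lemma descent_power_sum_pos: "descent_power_sum r n > 0"
proof -
  have "descent_set n id = {}" by (auto simp: descent_set_def)
  then have "id \<in> {\<pi>. \<pi> permutes {1..n} \<and> descent_set n \<pi> = {}}"
    by (simp add: permutes_id)
  moreover have "finite {\<pi>. \<pi> permutes {1..n} \<and> descent_set n \<pi> = {}}"
    by (rule finite_subset[OF _ finite_permutations[of "{1..n}"]]) auto
  ultimately have "descent_count n {} > 0"
    unfolding descent_count_def card_gt_0_iff by blast
  then have "0 < descent_count n {} ^ r" by simp
  also have "\<dots> \<le> descent_power_sum r n"
    unfolding descent_power_sum_def by (rule member_le_sum) auto
  finally show ?thesis .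
qed

text \<open>The hypothesis on \<open>K\<close> says that \<open>K\<close> is at most every natural
  \<open>k\<close> above the claimed bound, stated without division. It suffices that each covering
  tuple contributes a term whose guaranteed exponent is such a \<open>k\<close>.\<close>

lemma prime_power_dvd_descent_power_sum:
  assumes p: "prime p" and n: "n > 0" and r: "odd r"
    and K: "\<And>k. n - 1 + r \<le> (p - 1) * k + r * digit_sum p n \<Longrightarrow> K \<le> k"
  shows "p ^ K dvd descent_power_sum r n"
proof -
  let ?X = "{1..n - 1}"
  \<comment> \<open>The expansion has signs, so the argument moves to the integers.\<close>
  have "int (descent_power_sum r n) = (\<Sum>S\<in>Pow ?X. int (descent_count n S) ^ r)"
    by (simp add: descent_power_sum_def)
  also have "\<dots> = (\<Sum>h | h \<in> {..<r} \<rightarrow>\<^sub>E Pow ?X \<and> (\<Union>j<r. h j) = ?X.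
      (-1) ^ card ?X * (\<Prod>j<r. (-1) ^ card (h j) * int (descent_subset_count n (h j))))"
    using r by (intro sum_odd_power_Pow) (auto simp: descent_subset_count_eq_sum)
  finally have eq: "int (descent_power_sum r n) = \<dots>" .
  have "int p ^ K dvd int (descent_power_sum r n)"
    unfolding eq
  proof (rule dvd_sum, clarify)
    fix h assume h: "h \<in> {..<r} \<rightarrow>\<^sub>E Pow ?X" and Un: "(\<Union>j<r. h j) = ?X"
    have "\<forall>j\<in>{..<r}. \<exists>k. p ^ k dvd descent_subset_count n (h j) \<and>
        card (h j) + 1 \<le> (p - 1) * k + digit_sum p n"
    proof
      fix j assume "j \<in> {..<r}"
      then have "h j \<subseteq> ?X" using h by (auto simp: PiE_iff)
      from prime_power_dvd_descent_subset_count[OF p this n]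
      show "\<exists>k. p ^ k dvd descent_subset_count n (h j) \<and>
        card (h j) + 1 \<le> (p - 1) * k + digit_sum p n" by metis
    qed
    then obtain k where k: "\<And>j. j < r \<Longrightarrow> p ^ k j dvd descent_subset_count n (h j)"
        "\<And>j. j < r \<Longrightarrow> card (h j) + 1 \<le> (p - 1) * k j + digit_sum p n"
      by (metis lessThan_iff)
    have "n - 1 = card (\<Union>j<r. h j)" by (simp add: Un)
    also have "\<dots> \<le> (\<Sum>j<r. card (h j))" by (rule card_UN_le) simp
    \<comment> \<open>Covering \<open>?X\<close> forces the sizes to add up to at least
      \<open>n - 1\<close>; the \<open>r\<close> extra units come from the \<open>+ 1\<close> in
      each factor's bound.\<close>
    finally have "n - 1 + r \<le> (\<Sum>j<r. card (h j) + 1)" by (simp add: sum_Suc)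
    also have "\<dots> \<le> (\<Sum>j<r. (p - 1) * k j + digit_sum p n)" using k(2) by (intro sum_mono) auto
    also have "\<dots> = (p - 1) * (\<Sum>j<r. k j) + r * digit_sum p n"
      by (simp add: sum.distrib sum_distrib_left)
    finally have "K \<le> (\<Sum>j<r. k j)" by (rule K)
    then have "int p ^ K dvd int p ^ (\<Sum>j<r. k j)" by (rule le_imp_power_dvd)
    also have "\<dots> = (\<Prod>j<r. int p ^ k j)" by (simp add: power_sum)
    also have "\<dots> dvd (\<Prod>j<r. (-1) ^ card (h j) * int (descent_subset_count n (h j)))"
      using k(1) by (intro prod_dvd_prod dvd_mult) (auto simp flip: of_nat_power)
    finally show "int p ^ K dvd
        (-1) ^ card ?X * (\<Prod>j<r. (-1) ^ card (h j) * int (descent_subset_count n (h j)))"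
      by (rule dvd_mult)
  qed
  then show ?thesis by (simp flip: of_nat_power)
qed

theorem theorem4p5:
  fixes p n r :: nat
  assumes "prime p" and "n > 0" and "r > 0" and "odd r"
  shows "real (multiplicity p (descent_power_sum r n))
           \<ge> (real n - 1 - real r * real_of_int (digit_defect p n)) / (real p - 1)"
proof -
  let ?x = "(real n - 1 - real r * real_of_int (digit_defect p n)) / (real p - 1)"
  have p2: "p \<ge> 2" using assms(1) by (rule prime_ge_2_nat)
  \<comment> \<open>The exponent is the bound rounded up; \<open>nat\<close> sends a negative bound
    to 0, where nothing is to be shown.\<close>
  have "p ^ nat \<lceil>?x\<rceil> dvd descent_power_sum r n"
  proof (rule prime_power_dvd_descent_power_sum[OF assms(1,2,4)])
    fix k assume "n - 1 + r \<le> (p - 1) * k + r * digit_sum p n"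
    then have "real (n - 1 + r) \<le> real ((p - 1) * k + r * digit_sum p n)"
      by (simp only: of_nat_le_iff)
    then have "real n - 1 + real r \<le> (real p - 1) * real k + real r * real (digit_sum p n)"
      using assms(2) p2 by (simp add: of_nat_diff)
    then have "?x \<le> real k"
      using p2 by (simp add: digit_defect_def divide_le_eq algebra_simps)
    then show "nat \<lceil>?x\<rceil> \<le> k" by (simp add: ceiling_le_iff nat_le_iff)
  qed
  then have "nat \<lceil>?x\<rceil> \<le> multiplicity p (descent_power_sum r n)"
    \<comment> \<open>Positivity is essential to pass from divisibility to the exponent, as the
      multiplicity in 0 is 0 by convention.\<close>
    using descent_power_sum_pos[of r n] p2 by (intro multiplicity_geI) auto
  then show ?thesis by linarith
qed

end
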